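(* Let $n\geq 3$ and let $\mathbb{J}_{n}=\mathrm{circ}(J_{1},J_{2},\ldots ,J_{n})$. Put $$g_{n}=1-J_{n}+2\sum_{k=1}^{n-2}J_{n-k-1}\left( \frac{2J_{n}}{1-J_{n+1}}\right) ^{k}.$$ Then the inverse of $\mathbb{J}_{n}$ is $$\mathbb{J}_{n}^{-1}=\mathrm{circ}(m_{1},m_{2},\ldots ,m_{n}),$$ where $$m_{1}=\frac{J_{n+1}+(1-2J_{n-1})g_{n}-1}{2g_{n}J_{n}^{2}},\qquad m_{2}=\frac{g_{n}-1}{J_{n}g_{n}},$$ $$m_{3}=\frac{1}{g_{n}}\left[ (1-J_{n}-g_{n})\frac{(1-J_{n+1})^{n-3}}{(2J_{n})^{n-2}}+2\sum_{k=2}^{n-2}J_{n-k}\frac{(1-J_{n+1})^{n-k-2}}{(2J_{n})^{n-k-1}}\right],$$ $$m_{4}=\frac{1}{g_{n}}\left( \frac{[(1-J_{n}-g_{n})(J_{n+2}-1)-4J_{n}J_{n-2}](1-J_{n+1})^{n-4}}{(2J_{n})^{n-2}}+4\sum_{k=1}^{n-4}J_{k}\frac{(1-J_{n+1})^{k-1}}{(2J_{n})^{k}}\right)$$ (for $n\ge 4$), and, for $i=5,6,\ldots ,n$, $$m_{i}=\frac{1}{g_{n}}\frac{(1-J_{n+1})^{n-i}}{(2J_{n})^{n-i+1}}\cdot \begin{cases} \dfrac{(1-J_{n}-g_{n})(2^{n+2}-4)}{(2J_{n})^{2}}-2\left( J_{n-1}+\dfrac{J_{n-2}(1-J_{n+1})}{J_{n}}\right),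 & n\text{ odd},\\[2ex] -2\left( J_{n-1}+\dfrac{J_{n-2}(1-J_{n+1})}{J_{n}}\right), & n\text{ even}. \end{cases}$$
   Context: The Jacobsthal numbers are defined by $J_0=0$, $J_1=1$, $J_{k}=J_{k-1}+2J_{k-2}$ for $k\ge 2$. For numbers $c_0,\dots,c_{n-1}$, $\mathrm{circ}(c_0,c_1,\ldots,c_{n-1})$ denotes the $n\times n$ circulant matrix whose first row is $(c_0,c_1,\ldots,c_{n-1})$ and each of whose later rows is the cyclic right shift by one of the row above; i.e. the $(i,j)$ entry ($1\le i,j\le n$) is $c_{(j-i)\bmod n}$. In particular $\mathrm{circ}(J_1,\dots,J_n)$ has first row $(J_1,\dots,J_n)$ and $\mathrm{circ}(m_1,\dots,m_n)$ has first row $(m_1,\dots,m_n)$. Empty sums are $0$. *)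

theory Defs
  imports Complex_Main "Jordan_Normal_Form.Matrix"
begin

fun jacobsthal :: "nat \<Rightarrow> nat" where
  "jacobsthal 0 = 0"
| "jacobsthal (Suc 0) = 1"
| "jacobsthal (Suc (Suc k)) = jacobsthal (Suc k) + 2 * jacobsthal k"

abbreviation J :: "nat \<Rightarrow> real" where
  "J k \<equiv> real (jacobsthal k)"

(* cs is the first row. For matrix indices i, j < n the residue of j - i modulo n is
   (j + n - i) mod n, where the natural number subtraction does not truncate. *)
definition circ :: "'a list \<Rightarrow> 'a mat" where
  "circ cs = (let n = length cs in mat n n (\<lambda>(i, j). cs ! ((j + n - i) mod n)))"

definition circ_jacobsthal :: "nat \<Rightarrow> real mat" where
  "circ_jacobsthal n = circ (map J [1..<n + 1])"

definition g :: "nat \<Rightarrow> real" where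
  "g n = 1 - J n + 2 * (\<Sum>k = 1..n - 2. J (n - k - 1) * (2 * J n / (1 - J (n + 1))) ^ k)"

(* Meant for 3 \<le> n and 1 \<le> i \<le> n; then no subtraction of natural numbers truncates. *)
definition inv_entry :: "nat \<Rightarrow> nat \<Rightarrow> real" where
  "inv_entry n i =
    (if i = 1 then
       (J (n + 1) + (1 - 2 * J (n - 1)) * g n - 1) / (2 * g n * (J n)\<^sup>2)
     else if i = 2 then
       (g n - 1) / (J n * g n)
     else if i = 3 then
       1 / g n *
         ((1 - J n - g n) * ((1 - J (n + 1)) ^ (n - 3) / (2 * J n) ^ (n - 2))
          + 2 * (\<Sum>k = 2..n - 2.
                   J (n - k) * ((1 - J (n + 1)) ^ (n - k - 2) / (2 * J n) ^ (n - k - 1))))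
     else if i = 4 then
       1 / g n *
         (((1 - J n - g n) * (J (n + 2) - 1) - 4 * J n * J (n - 2)) * (1 - J (n + 1)) ^ (n - 4)
            / (2 * J n) ^ (n - 2)
          + 4 * (\<Sum>k = 1..n - 4. J k * ((1 - J (n + 1)) ^ (k - 1) / (2 * J n) ^ k)))
     else
       1 / g n * ((1 - J (n + 1)) ^ (n - i) / (2 * J n) ^ (n - i + 1)) *
         (if odd n then
            (1 - J n - g n) * (2 ^ (n + 2) - 4) / (2 * J n)\<^sup>2
            - 2 * (J (n - 1) + J (n - 2) * (1 - J (n + 1)) / J n)
          else
            - 2 * (J (n - 1) + J (n - 2) * (1 - J (n + 1)) / J n)))"

end

theory Submission
  imports Defs "Jordan_Normal_Form.Determinant"
begin

text \<open>
  Put \<open>a = 1 - J\<^sub>n\<^sub>+\<^sub>1\<close>, \<open>b = 2J\<^sub>n\<close> and \<open>t = a / b\<close>. Writing the finite sums in terms of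
  \<open>T = J\<^sub>1t + \<dots> + J\<^sub>n\<^sub>-\<^sub>2t\<^sup>n\<^sup>-\<^sup>2\<close>, all the entries \<open>m\<^sub>i\<close> with \<open>i \<ge> 3\<close> collapse to the geometric
  sequence \<open>-2 / (g\<^sub>n b t\<^sup>i\<^sup>-\<^sup>2)\<close>. Identify circulants with elements of \<open>\<real>[x] / (x\<^sup>n - 1)\<close>. Then
  multiplication by \<open>1 - x - 2x\<^sup>2\<close> turns the Jacobsthal circulant into \<open>a - bx\<close>, and \<open>m\<close> satisfies
  \<open>(a - bx) m = 1 - x - 2x\<^sup>2\<close>. Hence the product of the two circulants differs from \<open>1\<close> by a
  sequence of period \<open>n\<close> that is annihilated by \<open>(1 + x)(1 - 2x)\<close>, that is, by a multiple of
  \<open>(-1)\<^sup>k\<close>. This multiple vanishes by periodicity if \<open>n\<close> is odd; if \<open>n\<close> is even, then \<open>t = -1\<close> and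
  one coefficient of the product is computed explicitly.
\<close>

section \<open>Jacobsthal numbers: identities, bounds and power sums\<close>

lemma J_Suc_Suc: "J (Suc (Suc k)) = J (Suc k) + 2 * J k"
  by simp

lemma J_Suc: "J (Suc k) = 2 * J k + (-1) ^ k"
proof (induction k)
  case (Suc k)
  then show ?case using J_Suc_Suc[of k] by simp
qed simp

lemma J_Suc_add: "J (Suc k) + J k = 2 ^ k"
proof (induction k)
  case (Suc k)
  then show ?case using J_Suc_Suc[of k] by simp
qed simp

lemma jacobsthal_pos: "0 < k \<Longrightarrow> 0 < jacobsthal k"
  by (induction k rule: jacobsthal.induct) auto

text \<open>This crude bound settles all sign questions: \<open>J (n + 1) > 1\<close> makes
  \<open>ratio n\<close> negative, and \<open>J n \<ge> n\<close> makes \<open>g n\<close> negative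
  for even \<open>n\<close>.\<close>

lemma le_jacobsthal: "3 \<le> n \<Longrightarrow> n \<le> jacobsthal n"
proof (induction n rule: dec_induct)
  case (step m)
  then obtain k where "m = Suc k" "0 < k"
    by (cases m) auto
  then show ?case using step jacobsthal_pos[of k] by simp
qed (simp add: numeral_3_eq_3)

text \<open>The factor \<open>1 - t - 2 * t\<^sup>2\<close> is the denominator of the Jacobsthal
  generating function, so only boundary terms survive. Without division by it, the identity also
  holds at the roots \<open>-1\<close> and \<open>1 / 2\<close>.\<close>

lemma sum_J_power:
  "(1 - t - 2 * t\<^sup>2) * (\<Sum>l = 1..N. J l * t ^ l)
    = t - J (Suc N) * t ^ Suc N - 2 * J N * t ^ Suc (Suc N)"
proof (induction N)
  case (Suc N)
  have "(1 - t - 2 * t\<^sup>2) * (\<Sum>l = 1..Suc N. J l * t ^ l)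
      = t - J (Suc N) * t ^ Suc N - 2 * J N * t ^ Suc (Suc N)
        + (1 - t - 2 * t\<^sup>2) * (J (Suc N) * t ^ Suc N)"
    by (simp only: Suc[symmetric]) (simp add: algebra_simps)
  then show ?case
    by (simp add: algebra_simps power2_eq_square)
qed simp

text \<open>At the root \<open>t = -1\<close>, which is the ratio for even \<open>n\<close>,
  \<open>sum_J_power\<close> does not determine the sum; this evaluation takes its place.\<close>

lemma sum_J_alternating: "3 * (\<Sum>l<N. (-1) ^ l * J l) = - ((-1) ^ N * J N) - real N"
proof (induction N)
  case (Suc N)
  have "(-1) ^ N * ((-1) ^ N :: real) = 1"
    by (simp flip: power_add)
  then show ?case
    using Suc J_Suc[of N] by (simp add: algebra_simps)
qed simp

section \<open>The ratio of the geometric sequence and the nonvanishing of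
  \<open>g n\<close>\<close>

definition ratio :: "nat \<Rightarrow> real" where
  "ratio n = (1 - J (n + 1)) / (2 * J n)"

definition geo :: "nat \<Rightarrow> real" where
  "geo n = (\<Sum>l = 1..n - 2. J l * ratio n ^ l)"

lemma J_pos: "3 \<le> n \<Longrightarrow> 0 < J n"
  using le_jacobsthal[of n] by simp

lemma ratio_neg:
  assumes "3 \<le> n"
  shows "ratio n < 0"
  using le_jacobsthal[of n] le_jacobsthal[of "n + 1"] assms
  by (simp add: ratio_def divide_less_0_iff)

lemma ratio_J: "3 \<le> n \<Longrightarrow> 1 - J (n + 1) = ratio n * (2 * J n)"
  using J_pos[of n] by (simp add: ratio_def)

text \<open>The quadratic factors as \<open>(1 + t) * (1 - 2 * t)\<close>; after scaling, the
  factors become \<open>1 - (-1) ^ n\<close> and \<open>2 * 2 ^ n - 2\<close>. This explains the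
  split by parity in the entries with \<open>i \<ge> 5\<close>.\<close>

lemma J_ratio_quadratic:
  assumes "3 \<le> n"
  shows "(1 - ratio n - 2 * (ratio n)\<^sup>2) * (2 * J n)\<^sup>2 = (if odd n then 2 ^ (n + 2) - 4 else 0)"
proof -
  have "(1 - ratio n - 2 * (ratio n)\<^sup>2) * (2 * J n)\<^sup>2
      = (2 * J n + (1 - J (n + 1))) * (2 * J n - 2 * (1 - J (n + 1)))"
    by (simp only: ratio_J[OF assms]) (simp add: algebra_simps power2_eq_square)
  also have "2 * J n + (1 - J (n + 1)) = 1 - (-1) ^ n"
    using J_Suc[of n] by simp
  also have "2 * J n - 2 * (1 - J (n + 1)) = 2 * 2 ^ n - 2"
    using J_Suc_add[of n] by simp
  finally show ?thesis by auto
qed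

lemma ratio_even:
  assumes "3 \<le> n" "even n"
  shows "ratio n = -1"
  using J_Suc[of n] J_pos[of n] assms by (simp add: ratio_def)

lemma g_eq_geo:
  assumes "3 \<le> n"
  shows "g n = 1 - J n + 2 * geo n / ratio n ^ (n - 1)"
proof -
  have t: "ratio n \<noteq> 0" using ratio_neg[OF assms] by simp
  have inv: "2 * J n / (1 - J (n + 1)) = 1 / ratio n"
    by (simp add: ratio_def)
  \<comment> \<open>Reversing the sum by \<open>k = n - 1 - l\<close> turns negative powers of the
    ratio into positive ones, up to the common factor \<open>1 / ratio n ^ (n - 1)\<close>.\<close>
  have "(\<Sum>k = 1..n - 2. J (n - k - 1) * (2 * J n / (1 - J (n + 1))) ^ k)
      = (\<Sum>k = 1..n - 2. J (n - (n - 2 + 1 - k) - 1) * (1 / ratio n) ^ (n - 2 + 1 - k))"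
    unfolding inv by (rule sum.atLeastAtMost_rev)
  also have "\<dots> = (\<Sum>l = 1..n - 2. J l * ratio n ^ l / ratio n ^ (n - 1))"
  proof (rule sum.cong[OF refl])
    fix l assume l: "l \<in> {1..n - 2}"
    have eq: "n - 2 + 1 - l = n - 1 - l" "n - (n - 1 - l) - 1 = l"
      using l assms by auto
    have "n - 1 = (n - 1 - l) + l"
      using l by auto
    then have "ratio n ^ (n - 1) = ratio n ^ (n - 1 - l) * ratio n ^ l"
      by (metis power_add)
    then show "J (n - (n - 2 + 1 - l) - 1) * (1 / ratio n) ^ (n - 2 + 1 - l)
        = J l * ratio n ^ l / ratio n ^ (n - 1)"
      unfolding eq using t by (simp add: power_one_over)
  qed
  also have "\<dots> = geo n / ratio n ^ (n - 1)"
    by (simp only: geo_def sum_divide_distrib)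
  finally show ?thesis
    unfolding g_def by simp
qed

text \<open>After \<open>sum_J_power\<close> with \<open>N = n - 2\<close>, all Jacobsthal terms
  cancel by the recurrence and \<open>a = t * b\<close>. The identity gives
  \<open>g n \<noteq> 0\<close> for odd \<open>n\<close> and closes the cycle of entries in
  \<open>inv_entry_step\<close>.\<close>

lemma g_quadratic:
  assumes "3 \<le> n"
  shows "g n * (1 - ratio n - 2 * (ratio n)\<^sup>2) = 2 * (ratio n)\<^sup>2 * (1 / ratio n ^ n - 1)"
proof -
  define m where "m = n - 2"
  then have n: "n = Suc (Suc m)"
    using assms by simp
  define t where "t = ratio n"
  have t: "t \<noteq> 0" using ratio_neg[OF assms] by (simp add: t_def)
  have a: "1 - J (n + 1) = t * (2 * J n)"
    using ratio_J[OF assms] by (simp add: t_def)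
  have rec: "J n = J (Suc m) + 2 * J m" "J (n + 1) = J n + 2 * J (Suc m)"
    unfolding n by simp_all
  have "g n * (1 - t - 2 * t\<^sup>2)
      = (1 - J n) * (1 - t - 2 * t\<^sup>2) + 2 * ((1 - t - 2 * t\<^sup>2) * geo n) / t ^ (n - 1)"
    unfolding g_eq_geo[OF assms] t_def[symmetric]
    by (simp add: algebra_simps add_divide_distrib diff_divide_distrib)
  also have "(1 - t - 2 * t\<^sup>2) * geo n = t - J (Suc m) * t ^ Suc m - 2 * J m * t ^ Suc (Suc m)"
    unfolding geo_def t_def[symmetric] using sum_J_power[of t m] by (simp add: n)
  also have "2 * \<dots> / t ^ (n - 1) = 2 / t ^ m - 2 * J (Suc m) - 4 * J m * t"
    using t by (simp add: n field_simps)
  also have "(1 - J n) * (1 - t - 2 * t\<^sup>2) + (2 / t ^ m - 2 * J (Suc m) - 4 * J m * t)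
      = 2 / t ^ m - 2 * t\<^sup>2"
  proof -
    have "2 * J n * t\<^sup>2 = t * (1 - J (n + 1))"
      by (simp only: a) (simp add: power2_eq_square)
    moreover have "(1 - J n) * (1 - t - 2 * t\<^sup>2) = 1 - t - 2 * t\<^sup>2 - J n + J n * t + 2 * J n * t\<^sup>2"
      by (simp add: algebra_simps)
    ultimately show ?thesis
      using a rec by (simp add: algebra_simps)
  qed
  also have "\<dots> = 2 * t\<^sup>2 * (1 / t ^ n - 1)"
    using t by (simp add: n field_simps power2_eq_square)
  finally show ?thesis by (simp add: t_def)
qed

lemma g_even:
  assumes "3 \<le> n" "even n"
  shows "3 * g n = 2 * (real n - 2 * J n)"
proof -
  define m where "m = n - 2"
  then have n: "n = Suc (Suc m)"
    using assms by simp
  have m: "even m" using assms n by simp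
  have "geo n = (\<Sum>l = 1..m. J l * (-1) ^ l)"
    unfolding geo_def ratio_even[OF assms] by (simp add: n)
  also have "\<dots> = (\<Sum>l<Suc m. (-1) ^ l * J l)"
    by (rule sum.mono_neutral_cong_left) (auto simp: not_le)
  finally have "3 * geo n = J (Suc m) - real (Suc m)"
    using sum_J_alternating[of "Suc m"] m by simp
  moreover have "J n = 2 * J (Suc m) - 1"
    using J_Suc[of "Suc m"] m unfolding n by simp
  moreover have "g n = 1 - J n - 2 * geo n"
    unfolding g_eq_geo[OF assms(1)] ratio_even[OF assms] using assms by simp
  ultimately show ?thesis
    using J_Suc_Suc[of m] by (simp add: n)
qed

text \<open>For even \<open>n\<close>, \<open>g_even\<close> and \<open>J n \<ge> n\<close> give a
  negative value. For odd \<open>n\<close>, \<open>ratio n ^ n\<close> is negative, so the right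
  side of \<open>g_quadratic\<close> cannot vanish.\<close>

lemma g_nonzero:
  assumes "3 \<le> n"
  shows "g n \<noteq> 0"
proof (cases "even n")
  case True
  then show ?thesis
    using g_even[OF assms] le_jacobsthal[OF assms] assms by auto
next
  case False
  have t: "ratio n < 0" using ratio_neg[OF assms] .
  then have "1 / ratio n ^ n < 0" using False by (simp add: divide_less_0_iff)
  then have "1 / ratio n ^ n - 1 \<noteq> 0" by linarith
  then have "g n * (1 - ratio n - 2 * (ratio n)\<^sup>2) \<noteq> 0"
    unfolding g_quadratic[OF assms] using t by (simp del: right_minus_eq)
  then show ?thesis by auto
qed

section \<open>Closed form of the inverse entries and the relations between neighbours\<close>

lemma inv_entry_ge_3:
  assumes "3 \<le> i" "i \<le> n"
  shows "inv_entry n i = - 2 / (g n * (2 * J n) * ratio n ^ (i - 2))"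
proof -
  have n3: "3 \<le> n" using assms by simp
  define m where "m = n - 2"
  then have n: "n = Suc (Suc m)"
    using n3 by simp
  have m1: "1 \<le> m" using n n3 by simp
  define t where "t = ratio n"
  define b where "b = 2 * J n"
  have t: "t \<noteq> 0" using ratio_neg[OF n3] by (simp add: t_def)
  have b: "b \<noteq> 0" using J_pos[OF n3] by (simp add: b_def)
  have a: "1 - J (n + 1) = t * b"
    using ratio_J[OF n3] by (simp add: t_def b_def)
  have G: "1 - J n - g n = - 2 * geo n / t ^ Suc m"
    using g_eq_geo[OF n3] by (simp add: t_def n)
  have geo: "(1 - t - 2 * t\<^sup>2) * geo n = t - J (Suc m) * t ^ Suc m - 2 * J m * t ^ Suc (Suc m)"
    unfolding geo_def t_def[symmetric] using sum_J_power[of t m] by (simp add: n)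
  consider "i = 3" | "i = 4" | "i \<ge> 5" using assms by linarith
  then show ?thesis
  proof cases
    case 1
    have "(\<Sum>k = 2..n - 2. J (n - k) * ((1 - J (n + 1)) ^ (n - k - 2) / b ^ (n - k - 1)))
        = (\<Sum>l = 2..m. J (n - (m + 2 - l))
            * ((1 - J (n + 1)) ^ (n - (m + 2 - l) - 2) / b ^ (n - (m + 2 - l) - 1)))"
      by (subst sum.atLeastAtMost_rev) (simp add: n)
    also have "\<dots> = (\<Sum>l = 2..m. J l * t ^ l / (b * t\<^sup>2))"
    proof (rule sum.cong[OF refl])
      fix l assume "l \<in> {2..m}"
      moreover define k where "k = l - 2"
      ultimately have l: "l = Suc (Suc k)" "Suc (Suc k) \<le> m"
        by auto
      have eq: "n - (m + 2 - l) = l" using l n by simp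
      show "J (n - (m + 2 - l))
          * ((1 - J (n + 1)) ^ (n - (m + 2 - l) - 2) / b ^ (n - (m + 2 - l) - 1))
          = J l * t ^ l / (b * t\<^sup>2)"
        unfolding eq a using t b
        by (simp add: l power_mult_distrib power2_eq_square del: jacobsthal.simps)
    qed
    \<comment> \<open>The sum starts at \<open>l = 2\<close>, so the term \<open>J 1 * t = t\<close>
      of \<open>geo n\<close> is missing.\<close>
    also have "\<dots> = (geo n - t) / (b * t\<^sup>2)"
    proof -
      have "geo n = t + (\<Sum>l = 2..m. J l * t ^ l)"
        using m1 by (simp add: geo_def t_def n sum.atLeast_Suc_atMost numeral_2_eq_2)
      then show ?thesis by (simp add: sum_divide_distrib)
    qed
    finally have S: "(\<Sum>k = 2..n - 2. J (n - k) * ((1 - J (n + 1)) ^ (n - k - 2) / b ^ (n - k - 1)))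
        = (geo n - t) / (b * t\<^sup>2)" .
    have P: "(1 - J (n + 1)) ^ (n - 3) / b ^ (n - 2) = t ^ (m - 1) / b"
      using b m1 unfolding a by (cases m) (simp_all add: n power_mult_distrib)
    have "inv_entry n i = 1 / g n * ((- 2 * geo n / t ^ Suc m) * (t ^ (m - 1) / b)
        + 2 * ((geo n - t) / (b * t\<^sup>2)))"
      using 1 by (simp only: inv_entry_def b_def[symmetric] S P G) simp
    also have "(- 2 * geo n / t ^ Suc m) * (t ^ (m - 1) / b) = - 2 * geo n / (b * t\<^sup>2)"
      using t m1 by (cases m) (simp_all add: power2_eq_square)
    also have "\<dots> + 2 * ((geo n - t) / (b * t\<^sup>2)) = - 2 / (b * t)"
      using t b by (simp add: field_simps power2_eq_square)
    finally show ?thesis using 1 by (simp add: t_def b_def)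
  next
    case 2
    define p where "p = m - 2"
    then have m: "m = Suc (Suc p)"
      using 2 assms n by simp
    have "(\<Sum>k = 1..n - 4. J k * ((1 - J (n + 1)) ^ (k - 1) / b ^ k))
        = (\<Sum>k = 1..p. J k * t ^ k / (b * t))"
    proof (rule sum.cong)
      fix k assume "k \<in> {1..p}"
      then obtain j where k: "k = Suc j" by (cases k) auto
      show "J k * ((1 - J (n + 1)) ^ (k - 1) / b ^ k) = J k * t ^ k / (b * t)"
        unfolding a using t b by (simp add: k power_mult_distrib)
    qed (simp add: n m)
    also have "\<dots> = (geo n - J (Suc p) * t ^ Suc p - J m * t ^ m) / (b * t)"
    proof -
      have "geo n = (\<Sum>k = 1..p. J k * t ^ k) + J (Suc p) * t ^ Suc p + J m * t ^ m"
        by (simp add: geo_def t_def n m del: jacobsthal.simps)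
      then show ?thesis by (simp add: sum_divide_distrib)
    qed
    finally have S: "(\<Sum>k = 1..n - 4. J k * ((1 - J (n + 1)) ^ (k - 1) / b ^ k))
        = (geo n - J (Suc p) * t ^ Suc p - J m * t ^ m) / (b * t)" .
    have P: "(1 - J (n + 1)) ^ (n - 4) = t ^ p * b ^ p" "b ^ (n - 2) = b ^ p * b\<^sup>2"
      unfolding a by (simp_all add: n m power_mult_distrib power2_eq_square)
    have Q: "J (n + 2) - 1 = b - t * b" "4 * J n * J (n - 2) = 2 * b * J m"
      using a J_Suc_Suc[of n] by (simp_all add: b_def n)
    have rec: "J (Suc m) = J m + 2 * J (Suc p)"
      unfolding m by simp
    have "inv_entry n i
        = 1 / g n * (((- 2 * geo n / t ^ Suc m) * (b - t * b) - 2 * b * J m) * (t ^ p * b ^ p)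
            / (b ^ p * b\<^sup>2)
          + 4 * ((geo n - J (Suc p) * t ^ Suc p - J m * t ^ m) / (b * t)))"
      using 2 by (simp only: inv_entry_def b_def[symmetric] S P Q G) (simp add: b_def)
    \<comment> \<open>The terms are collected so that \<open>geo n\<close> appears with the factor
      \<open>1 - t - 2 * t\<^sup>2\<close>; then \<open>geo\<close> eliminates it.\<close>
    also have "((- 2 * geo n / t ^ Suc m) * (b - t * b) - 2 * b * J m) * (t ^ p * b ^ p)
            / (b ^ p * b\<^sup>2)
          + 4 * ((geo n - J (Suc p) * t ^ Suc p - J m * t ^ m) / (b * t))
        = - 2 / (b * t ^ 3) * ((1 - t - 2 * t\<^sup>2) * geo n
            + (J m + 2 * J (Suc p)) * t ^ Suc m + 2 * J m * t ^ Suc (Suc m))"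
      using t b by (simp add: m field_simps power2_eq_square power3_eq_cube del: jacobsthal.simps)
    also have "\<dots> = - 2 / (b * t\<^sup>2)"
      unfolding geo rec[symmetric] using t by (simp add: power2_eq_square power3_eq_cube)
    finally show ?thesis using 2 by (simp add: t_def b_def)
  next
    case 3
    \<comment> \<open>Setting \<open>e\<close> to zero for even \<open>n\<close> merges both parity
      cases of \<open>inv_entry\<close>; by \<open>J_ratio_quadratic\<close>,
      \<open>e / b\<^sup>2\<close> is the quadratic in either case.\<close>
    define e where "e = (if odd n then 2 ^ (n + 2) - 4 else 0 :: real)"
    have e: "e / b\<^sup>2 = 1 - t - 2 * t\<^sup>2"
      using J_ratio_quadratic[OF n3] b by (simp add: e_def b_def t_def field_simps)
    have R: "J (n - 1) + J (n - 2) * (1 - J (n + 1)) / J n = J (Suc m) + 2 * J m * t"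
      unfolding a b_def using J_pos[OF n3] by (simp add: n del: jacobsthal.simps)
    have P: "(1 - J (n + 1)) ^ (n - i) / b ^ (n - i + 1) = t ^ (n - i) / b"
      using b unfolding a by (simp add: power_mult_distrib)
    have "inv_entry n i = 1 / g n * (t ^ (n - i) / b)
        * ((- 2 * geo n / t ^ Suc m) * e / b\<^sup>2 - 2 * (J (Suc m) + 2 * J m * t))"
      using 3 by (simp only: inv_entry_def b_def[symmetric] P R G e_def) simp
    also have "(- 2 * geo n / t ^ Suc m) * e / b\<^sup>2 - 2 * (J (Suc m) + 2 * J m * t)
        = - 2 / t ^ Suc m * ((e / b\<^sup>2) * geo n + J (Suc m) * t ^ Suc m + 2 * J m * t ^ Suc (Suc m))"
      using t b by (simp add: field_simps)
    also have "\<dots> = - 2 / t ^ m"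
      unfolding e geo using t by simp
    also have "1 / g n * (t ^ (n - i) / b) * (- 2 / t ^ m) = - 2 / (g n * b * t ^ (i - 2))"
    proof -
      have "t ^ m = t ^ (n - i) * t ^ (i - 2)"
        using assms by (simp add: n flip: power_add)
      then show ?thesis using t by simp
    qed
    finally show ?thesis by (simp add: t_def b_def)
  qed
qed

text \<open>These are the coefficients of \<open>(a - b x) m = 1 - x - 2 x^2\<close> modulo
  \<open>x^n - 1\<close>, where \<open>inv_entry n i\<close> is the coefficient of
  \<open>x^(i - 1)\<close>; the third relation is the wrap-around.\<close>

lemma inv_entry_step:
  assumes "3 \<le> n"
  defines "a \<equiv> 1 - J (n + 1)" and "b \<equiv> 2 * J n"
  shows "b * inv_entry n 2 = a * inv_entry n 3 + 2"
    and "b * inv_entry n 1 = a * inv_entry n 2 + 1"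
    and "b * inv_entry n n = a * inv_entry n 1 - 1"
    and "\<And>i. 3 \<le> i \<Longrightarrow> i < n \<Longrightarrow> b * inv_entry n i = a * inv_entry n (Suc i)"
proof -
  define t where "t = ratio n"
  have t: "t \<noteq> 0" using ratio_neg[OF assms(1)] by (simp add: t_def)
  have b: "b \<noteq> 0" using J_pos[OF assms(1)] by (simp add: b_def)
  have g: "g n \<noteq> 0" using g_nonzero[OF assms(1)] .
  have a: "a = t * b"
    using ratio_J[OF assms(1)] by (simp add: t_def b_def a_def)
  have ge3: "inv_entry n i = - 2 / (g n * b * t ^ (i - 2))" if "3 \<le> i" "i \<le> n" for i
    using inv_entry_ge_3[OF that] by (simp add: t_def b_def)
  have e2: "b * inv_entry n 2 = 2 * (g n - 1) / g n"
    using b by (simp add: inv_entry_def b_def)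
  have "J (n + 1) = J n + 2 * J (n - 1)"
    using assms J_Suc_Suc[of "n - 1"] by simp
  then have "1 - 2 * J (n - 1) = a + b / 2"
    by (simp add: a_def b_def)
  then have m1: "inv_entry n 1 = ((a + b / 2) * g n - a) / (2 * g n * (b / 2)\<^sup>2)"
    by (simp add: inv_entry_def a_def b_def algebra_simps)
  have e1: "b * inv_entry n 1 = 2 * t * (g n - 1) / g n + 1"
    unfolding m1 a using b g by (simp add: field_simps power2_eq_square)
  show "b * inv_entry n 2 = a * inv_entry n 3 + 2"
    unfolding e2 using assms(1) t b g by (simp add: ge3 a field_simps)
  show "b * inv_entry n 1 = a * inv_entry n 2 + 1"
    unfolding e1 a mult.assoc e2 by simp
  show "b * inv_entry n i = a * inv_entry n (Suc i)" if "3 \<le> i" "i < n" for i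
  proof -
    have "Suc i - 2 = Suc (i - 2)" using that by simp
    then show ?thesis using that t b g by (simp add: ge3 a)
  qed
  \<comment> \<open>Given \<open>ge3\<close>, the other relations need only
    \<open>g n \<noteq> 0\<close>. The wrap-around also needs this identity.\<close>
  have "g n * (1 - t - 2 * t\<^sup>2) = 2 * t\<^sup>2 * (1 / t ^ n - 1)"
    using g_quadratic[OF assms(1)] by (simp add: t_def)
  moreover have "t ^ n = t\<^sup>2 * t ^ (n - 2)"
  proof -
    have "2 + (n - 2) = n" using assms(1) by simp
    then show ?thesis using power_add[of t 2 "n - 2"] by (simp only:)
  qed
  ultimately have "g n * (1 - t - 2 * t\<^sup>2) = 2 / t ^ (n - 2) - 2 * t\<^sup>2"
    using t by (simp add: algebra_simps)
  then have p: "2 / t ^ (n - 2) = 2 * t\<^sup>2 * (1 - g n) - t * g n + g n"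
    by (simp add: algebra_simps)
  have l: "b * inv_entry n n = - (2 / t ^ (n - 2)) / g n"
    using assms(1) b by (simp add: ge3)
  have r: "a * inv_entry n 1 = t * (2 * t * (g n - 1) / g n + 1)"
    unfolding a using e1 by simp
  have "a * inv_entry n 1 - 1 = - (2 * t\<^sup>2 * (1 - g n) - t * g n + g n) / g n"
    unfolding r using g by (simp add: divide_simps) (simp add: algebra_simps power2_eq_square)
  then show "b * inv_entry n n = a * inv_entry n 1 - 1"
    unfolding l p ..
qed

section \<open>Cyclic convolution of the Jacobsthal numbers with the inverse entries\<close>

lemma J_convolution_telescope:
  fixes M :: "int \<Rightarrow> real"
  defines "p \<equiv> \<lambda>N k. \<Sum>i<N. J (Suc i) * M (k - int i)"
  shows "p N k - p N (k - 1) - 2 * p N (k - 2)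
    = M k - J (Suc N) * M (k - int N) - 2 * J N * M (k - int N - 1)"
proof (induction N)
  case (Suc N)
  have "k - 1 - int N = k - int N - 1" "k - 2 - int N = k - int N - 2"
    "k - int (Suc N) = k - int N - 1" "k - int (Suc N) - 1 = k - int N - 2"
    by simp_all
  then show ?case
    using Suc by (simp add: p_def algebra_simps)
qed (simp add: p_def)

text \<open>The sum \<open>u\<close> of two neighbours doubles at each step, so periodicity forces
  it to vanish and \<open>q\<close> alternates in sign. For even \<open>n\<close> the solution
  \<open>(-1) ^ k\<close> is periodic, hence the condition on \<open>q 0\<close>.\<close>

lemma periodic_J_recurrence:
  fixes q :: "int \<Rightarrow> real"
  assumes n: "0 < n" and per: "\<And>k. q (k - int n) = q k"
    and rec: "\<And>k. q k = q (k - 1) + 2 * q (k - 2)"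
    and zero: "odd n \<or> q 0 = 0"
  shows "q k = 0"
proof -
  define u where "u k = q k + q (k - 1)" for k
  have u: "u k = 2 * u (k - 1)" for k
    using rec[of k] by (simp add: u_def)
  have u_pow: "u k = 2 ^ j * u (k - int j)" for k j
  proof (induction j)
    case (Suc j)
    have eq: "k - int (Suc j) = k - int j - 1" by simp
    show ?case unfolding eq using Suc u[of "k - int j"] by simp
  qed simp
  have u_per: "u (k - int n) = u k" for k
  proof -
    have eq: "k - int n - 1 = k - 1 - int n" by simp
    show ?thesis unfolding u_def eq by (simp only: per)
  qed
  have "1 < (2::real) ^ n"
    using n by (intro one_less_power) simp_all
  then have "(2::real) ^ n \<noteq> 1"
    by linarith
  moreover have "u k = 2 ^ n * u k" for k
    using u_pow[of k n] unfolding u_per .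
  ultimately have u0: "u k = 0" for k
    by (metis mult_cancel_right1)
  have neg: "q k = - q (k - 1)" for k
    using u0[of k] unfolding u_def by linarith
  have alt: "q k = (-1) ^ j * q (k - int j)" for k j
  proof (induction j)
    case (Suc j)
    have eq: "k - int (Suc j) = k - int j - 1" by simp
    show ?case unfolding eq using Suc neg[of "k - int j"] by simp
  qed simp
  show ?thesis
  proof (cases "odd n")
    case True
    then have "q k = - q k" using alt[of k n] unfolding per by simp
    then show ?thesis by simp
  next
    case False
    then have "q 0 = 0" using zero by simp
    show ?thesis
    proof (cases "0 \<le> k")
      case True
      then show ?thesis using alt[of k "nat k"] \<open>q 0 = 0\<close> by simp
    next
      case False
      then show ?thesis using alt[of 0 "nat (- k)"] \<open>q 0 = 0\<close> by simp
    qed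
  qed
qed

lemma J_convolution_inv_entry:
  fixes n :: nat and k :: int
  assumes n: "3 \<le> n"
  defines "M \<equiv> \<lambda>k. inv_entry n (Suc (nat (k mod int n)))"
  shows "(\<Sum>i<n. J (Suc i) * M (k - int i)) = of_bool (int n dvd k)"
proof -
  define a where "a = 1 - J (n + 1)"
  define b where "b = 2 * J n"
  \<comment> \<open>Here \<open>p\<close> lists the coefficients of the product, and
    \<open>q\<close> is its deviation from the identity.\<close>
  define p where "p k = (\<Sum>i<n. J (Suc i) * M (k - int i))" for k
  define q where "q k = p k - of_bool (int n dvd k)" for k
  have b: "b \<noteq> 0" using J_pos[OF n] by (simp add: b_def)
  have M_per: "M (k - int n) = M k" for k
    by (simp add: M_def)
  have p_rec: "p k - p (k - 1) - 2 * p (k - 2) = a * M k - b * M (k - 1)" for k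
  proof -
    have "M (k - int n - 1) = M (k - 1)"
      using M_per[of "k - 1"] by (simp add: algebra_simps)
    then show ?thesis
      using J_convolution_telescope[where N = n and M = M and k = k] M_per[of k]
      by (simp add: p_def a_def b_def algebra_simps)
  qed
  have M_step: "a * M k - b * M (k - 1)
      = of_bool (int n dvd k) - of_bool (int n dvd k - 1) - 2 * of_bool (int n dvd k - 2)" for k
  proof -
    define i where "i = nat (k mod int n)"
    have i: "i < n" "k mod int n = int i"
      using n by (simp_all add: i_def nat_less_iff)
    have dvd: "int n dvd k - int j \<longleftrightarrow> i = j" if "j < n" for j
    proof -
      have "int n dvd k - int j \<longleftrightarrow> k mod int n = int j mod int n"
        by (simp add: mod_eq_dvd_iff)
      then show ?thesis using that i by simp
    qed
    have Mk: "M k = inv_entry n (Suc i)"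
      by (simp add: M_def i_def)
    have "(k - 1) mod int n = (int i - 1) mod int n"
      using i by (metis mod_diff_left_eq)
    also have "\<dots> = (if i = 0 then int n - 1 else int i - 1)"
      using i n by (auto simp: zmod_minus1)
    finally have Mk1: "M (k - 1) = inv_entry n (if i = 0 then n else i)"
      using n by (auto simp: M_def nat_diff_distrib)
    have d: "int n dvd k \<longleftrightarrow> i = 0" "int n dvd k - 1 \<longleftrightarrow> i = 1" "int n dvd k - 2 \<longleftrightarrow> i = 2"
      using dvd[of 0] dvd[of 1] dvd[of 2] n by simp_all
    note step = inv_entry_step[OF n, folded a_def b_def]
    consider "i = 0" | "i = 1" | "i = 2" | "3 \<le> i" by linarith
    then show ?thesis
    proof cases
      case 1
      then show ?thesis unfolding Mk Mk1 d using step(3) by simp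
    next
      case 2
      then show ?thesis unfolding Mk Mk1 d using step(2) by (simp add: numeral_2_eq_2)
    next
      case 3
      then show ?thesis unfolding Mk Mk1 d using step(1) by (simp add: numeral_3_eq_3)
    next
      case 4
      then show ?thesis unfolding Mk Mk1 d using step(4)[OF 4 i(1)] by simp
    qed
  qed
  have "q k = 0" for k
  proof (rule periodic_J_recurrence)
    show "0 < n" using n by simp
    show "q (k - int n) = q k" for k
    proof -
      have "M (k - int n - int i) = M (k - int i)" for i
        using M_per[of "k - int i"] by (simp add: algebra_simps)
      moreover have "int n dvd k - int n \<longleftrightarrow> int n dvd k"
        by (simp add: dvd_eq_mod_eq_0)
      ultimately show ?thesis unfolding q_def p_def by (simp only:)
    qed
    show "q k = q (k - 1) + 2 * q (k - 2)" for k
      unfolding q_def using p_rec[of k] M_step[of k] by argo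
    show "odd n \<or> q 0 = 0"
    proof (cases "even n")
      case True
      have t: "ratio n = -1" using ratio_even[OF n True] .
      have g: "g n \<noteq> 0" using g_nonzero[OF n] .
      have m3: "inv_entry n (Suc i) = 2 * (-1) ^ i / (g n * b)" if "2 \<le> i" "i < n" for i
      proof -
        define j where "j = i - 2"
        then have j: "i = Suc (Suc j)" using that by simp
        show ?thesis
          using that inv_entry_ge_3[of "Suc i" n] by (simp add: t b_def j minus_one_power_iff)
      qed
      have m2: "inv_entry n 2 = 2 / b - 2 / (g n * b)"
        using g b by (simp add: inv_entry_def b_def field_simps)
      have "a = - b"
        using ratio_J[OF n] t by (simp add: a_def b_def)
      then have eq: "b * inv_entry n 1 = 1 - b * inv_entry n 2"
        using inv_entry_step(2)[OF n] by (simp add: a_def b_def)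
      have "inv_entry n 1 = b * inv_entry n 1 / b"
        using b by simp
      also have "\<dots> = 2 / (g n * b) - 1 / b"
        unfolding eq m2 using b g by (simp add: divide_simps)
      finally have m1: "inv_entry n 1 = 2 / (g n * b) - 1 / b" .
      \<comment> \<open>The alternating formula extends to the first two entries, with corrections
        \<open>- 1 / b\<close> and \<open>2 / b\<close>.\<close>
      have m: "inv_entry n (Suc i)
          = 2 * (-1) ^ i / (g n * b) - of_bool (i = 0) / b + 2 * of_bool (i = 1) / b"
        if "i < n" for i
      proof -
        consider "i = 0" | "i = 1" | "2 \<le> i" by linarith
        then show ?thesis
        proof cases
          case 1
          then show ?thesis using m1 by simp
        next
          case 2
          then show ?thesis using m2 by (simp add: numeral_2_eq_2[symmetric])
        next
          case 3
          then show ?thesis using m3[OF 3 that] by simp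
        qed
      qed
      \<comment> \<open>For \<open>i > 0\<close> the residue of \<open>- i\<close> is
        \<open>n - i\<close>, of the same parity as \<open>i\<close> because \<open>n\<close> is
        even. The correction for residue 1 therefore sits at \<open>i = n - 1\<close>.\<close>
      have M_neg: "M (- int i)
          = 2 * (-1) ^ i / (g n * b) - of_bool (i = 0) / b + 2 * of_bool (Suc i = n) / b"
        if "i < n" for i
      proof (cases "i = 0")
        case False
        have "(- int i) mod int n = (int n - int i) mod int n"
          by simp
        also have "\<dots> = int n - int i"
          using False that by (intro mod_pos_pos_trivial) simp_all
        also have "\<dots> = int (n - i)"
          using that by simp
        finally have "M (- int i) = inv_entry n (Suc (n - i))"
          by (simp add: M_def)
        moreover have "(-1 :: real) ^ (n - i) = (-1) ^ i"
          using that True by (simp add: minus_one_power_iff)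
        moreover have "n - i = 1 \<longleftrightarrow> Suc i = n"
          using that by auto
        ultimately show ?thesis
          using m[of "n - i"] False that by simp
      qed (use m[of 0] n in \<open>simp add: M_def\<close>)
      have "(\<Sum>i<n. (-1) ^ i * J (Suc i)) = - (\<Sum>l<Suc n. (-1) ^ l * J l)"
        by (subst sum.lessThan_Suc_shift) (simp add: sum_negf)
      then have S: "(\<Sum>i<n. (-1) ^ i * J (Suc i)) = g n / 2"
        using sum_J_alternating[of "Suc n"] J_Suc[of n] g_even[OF n True] True by simp
      have "p 0 = (\<Sum>i<n. 2 / (g n * b) * ((-1) ^ i * J (Suc i))
          - (if i = 0 then J (Suc i) / b else 0) + (if i = n - 1 then 2 * J (Suc i) / b else 0))"
        unfolding p_def
      proof (rule sum.cong[OF refl])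
        fix i assume "i \<in> {..<n}"
        then have i: "i < n" "Suc i = n \<longleftrightarrow> i = n - 1" by auto
        then show "J (Suc i) * M (0 - int i) = 2 / (g n * b) * ((-1) ^ i * J (Suc i))
          - (if i = 0 then J (Suc i) / b else 0) + (if i = n - 1 then 2 * J (Suc i) / b else 0)"
          unfolding diff_0 M_neg[OF i(1)] i(2)
          by (cases "i = 0"; cases "i = n - 1") (simp_all add: algebra_simps)
      qed
      \<comment> \<open>The alternating part contributes \<open>1 / b\<close>, which the first
        correction cancels; the second contributes \<open>2 * J n / b = 1\<close>.\<close>
      also have "\<dots> = 2 / (g n * b) * (g n / 2) - 1 / b + 2 * J n / b"
      proof -
        have "(\<Sum>i<n. 2 / (g n * b) * ((-1) ^ i * J (Suc i))) = 2 / (g n * b) * (g n / 2)"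
          by (simp only: S flip: sum_distrib_left)
        moreover have "(\<Sum>i<n. if i = 0 then J (Suc i) / b else 0) = 1 / b"
          using n by simp
        moreover have "(\<Sum>i<n. if i = n - 1 then 2 * J (Suc i) / b else 0) = 2 * J n / b"
          using n by simp
        ultimately show ?thesis
          by (simp only: sum.distrib sum_subtractf)
      qed
      also have "\<dots> = 1"
        using g b by (simp add: b_def)
      finally show ?thesis by (simp add: q_def)
    qed simp
  qed
  from this[of k] show ?thesis by (simp add: q_def p_def)
qed

section \<open>Products of circulants and the inverse matrix\<close>

lemma sum_periodic_shift:
  fixes F :: "int \<Rightarrow> 'a :: comm_monoid_add"
  assumes "0 < n" and per: "\<And>k. F (k mod int n) = F k"
  shows "(\<Sum>j<n. F (int j - c)) = (\<Sum>j<n. F (int j))"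
proof (rule sum.reindex_bij_witness[where i = "\<lambda>l. nat ((int l + c) mod int n)"
      and j = "\<lambda>j. nat ((int j - c) mod int n)"])
  fix j assume "j \<in> {..<n}"
  then show "nat ((int (nat ((int j - c) mod int n)) + c) mod int n) = j"
    "nat ((int (nat ((int j + c) mod int n)) - c) mod int n) = j"
    using assms(1) by (simp_all add: mod_add_left_eq mod_diff_left_eq)
  show "nat ((int j - c) mod int n) \<in> {..<n}" "nat ((int j + c) mod int n) \<in> {..<n}"
    using assms(1) by (simp_all add: nat_less_iff)
  show "F (int (nat ((int j - c) mod int n))) = F (int j - c)"
    using assms(1) by (simp add: per)
qed

lemma circ_carrier: "circ cs \<in> carrier_mat (length cs) (length cs)"
  by (simp add: circ_def Let_def)

lemma circ_index:
  assumes "i < length cs" "j < length cs"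
  shows "circ cs $$ (i, j) = cs ! nat ((int j - int i) mod int (length cs))"
proof -
  have "int ((j + length cs - i) mod length cs) = (int j - int i + int (length cs)) mod int (length cs)"
    using assms by (simp add: zmod_int algebra_simps)
  then have "(j + length cs - i) mod length cs = nat ((int j - int i) mod int (length cs))"
    by simp
  then show ?thesis using assms by (simp add: circ_def Let_def)
qed

text \<open>Shifting the summation index by \<open>i\<close> over a full period makes the entry
  depend only on \<open>j - i\<close>: circulants multiply by cyclic convolution of their first
  rows.\<close>

lemma circ_mult_index:
  fixes cs ds :: "'a :: comm_semiring_0 list"
  assumes len: "length cs = n" "length ds = n" and ij: "i < n" "j < n"
  shows "(circ cs * circ ds) $$ (i, j)
    = (\<Sum>l<n. cs ! l * ds ! nat ((int j - int i - int l) mod int n))"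
proof -
  define F where "F l = cs ! nat (l mod int n) * ds ! nat ((int j - int i - l) mod int n)" for l
  have "(circ cs * circ ds) $$ (i, j) = (\<Sum>l<n. circ cs $$ (i, l) * circ ds $$ (l, j))"
    using circ_carrier[of cs] circ_carrier[of ds] len ij
    by (auto simp: scalar_prod_def lessThan_atLeast0 intro!: sum.cong)
  also have "\<dots> = (\<Sum>l<n. F (int l - int i))"
    using len ij by (intro sum.cong) (simp_all add: circ_index F_def)
  also have "\<dots> = (\<Sum>l<n. F (int l))"
    using ij by (intro sum_periodic_shift) (simp_all add: F_def mod_diff_right_eq)
  also have "\<dots> = (\<Sum>l<n. cs ! l * ds ! nat ((int j - int i - int l) mod int n))"
    by (intro sum.cong) (simp_all add: F_def)
  finally show ?thesis .
qed

theorem theorem5: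
  fixes n :: nat
  assumes "n \<ge> 3"
  shows "inverts_mat (circ_jacobsthal n) (circ (map (inv_entry n) [1..<n + 1]))
       \<and> inverts_mat (circ (map (inv_entry n) [1..<n + 1])) (circ_jacobsthal n)"
proof -
  define A where "A = circ_jacobsthal n"
  define B where "B = circ (map (inv_entry n) [1..<n + 1])"
  have A: "A \<in> carrier_mat n n" and B: "B \<in> carrier_mat n n"
    using circ_carrier[of "map J [1..<n + 1]"] circ_carrier[of "map (inv_entry n) [1..<n + 1]"]
    by (simp_all add: A_def B_def circ_jacobsthal_def del: upt_Suc)
  have "A * B = 1\<^sub>m n"
  proof (rule eq_matI)
    fix i j assume "i < dim_row (1\<^sub>m n :: real mat)" "j < dim_col (1\<^sub>m n :: real mat)"
    then have ij: "i < n" "j < n" by simp_all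
    have "(A * B) $$ (i, j) = (\<Sum>l<n. map J [1..<n + 1] ! l
        * map (inv_entry n) [1..<n + 1] ! nat ((int j - int i - int l) mod int n))"
      unfolding A_def B_def circ_jacobsthal_def using ij by (intro circ_mult_index) simp_all
    also have "\<dots> = (\<Sum>l<n. J (Suc l)
        * inv_entry n (Suc (nat ((int j - int i - int l) mod int n))))"
      using assms by (intro sum.cong) (simp_all add: nat_less_iff del: upt_Suc)
    also have "\<dots> = of_bool (int n dvd int j - int i)"
      by (rule J_convolution_inv_entry[OF assms])
    also have "int n dvd int j - int i \<longleftrightarrow> i = j"
      using ij by (auto simp flip: mod_eq_dvd_iff)
    finally show "(A * B) $$ (i, j) = 1\<^sub>m n $$ (i, j)"
      using ij by simp
  qed (use A B in auto)
  \<comment> \<open>For square matrices over a field, a right inverse is also a left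
    inverse.\<close>
  moreover from this have "B * A = 1\<^sub>m n"
    by (rule mat_mult_left_right_inverse[OF A B])
  ultimately show ?thesis
    using A B unfolding inverts_mat_def A_def[symmetric] B_def[symmetric] by auto
qed

end
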